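(* Let $X=(X_t)_{t\ge0}$ be a Lévy process in $\mathbb{R}^d$ with characteristic exponent $$\psi(\xi)=\int(1-\cos(\xi\cdot z))\,\nu(z)\,dz,\qquad\xi\in\mathbb{R}^d,$$ where $\nu(dx)=\nu(x)dx$ is a Lévy measure with $\nu(\mathbb{R}^d\setminus\{0\})=\infty$, $\nu(x)=\nu(-x)$, and there are a non-increasing function $g:(0,\infty)\to(0,\infty)$ and constants $C_{26}\in(0,1]$, $C_{27}\in[1,\infty)$ with $C_{26}\,g(|x|)\le\nu(x)\le C_{27}\,g(|x|)$ for $x\neq0$. Assume there exist $\gamma\in(0,2)$ and constants $C_{20},C_{21}>0$ such that $$C_{20}\,\lambda^{-d-\gamma}g(r)\le g(\lambda r)\le C_{21}\,\lambda^{-d-\gamma}g(r),\qquad\lambda\in(0,1],\ r\in(0,1],$$ and that $$g(r)=e^{-cr^\beta}r^{-\delta},\quad r\ge1,\qquad\text{with }c>0,\ \beta>1\text{ and }\delta\ge0.$$ Let $V$ be an $X$-Kato decomposable potential with $V(x)\to0$ as $|x|\to\infty$. If a ground state $\varphi_0$ of the non-local Schrödinger operator $H$ at eigenvalue $\lambda_0<0$ exists, then there is a constant $C_{37}>0$ such that for every $\varepsilon>0$ there exist $C_{38}>0$ and $R>0$ for which $$\varphi_0(x)\ge C_{38}\,e^{-C_{37}\sqrt{(|\lambda_0|+\varepsilon)\wedge1}\;|x|\,(\log|x|)^{(\beta-1)/\beta}},\qquad|x|\ge R.$$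
   Context: $\mathbf{E}^x$ is the expectation for the process started at $x$; $\mathbf{E}^0[e^{i\xi\cdot X_t}]=e^{-t\psi(\xi)}$; $a\wedge b=\min(a,b)$. Potentials. $V\in\mathcal{K}^X$ if $\lim_{t\downarrow0}\sup_{x}\mathbf{E}^x[\int_0^t|V(X_s)|ds]=0$; $V\in\mathcal{K}^X_{\rm loc}$ if $V\mathbf 1_B\in\mathcal{K}^X$ for all compact $B$. A Borel $V:\mathbb{R}^d\to\mathbb{R}$ is $X$-Kato decomposable if $V_-\in\mathcal{K}^X$ and $V_+\in\mathcal{K}^X_{\rm loc}$, where $V_\pm$ are the positive and negative parts. Operator and eigenfunctions. $T_tf(x)=\mathbf{E}^x[e^{-\int_0^tV(X_s)ds}f(X_t)]$ defines a strongly continuous symmetric semigroup on $L^2(\mathbb{R}^d)$, and $H$ is the self-adjoint operator, bounded from below, with $e^{-tH}=T_t$. An eigenfunction at the eigenvalue $\lambda$ is $0\neq\varphi\in L^2(\mathbb{R}^d)$ with $T_t\varphi=e^{-\lambda t}\varphi$ for all $t>0$; eigenfunctions are normalized by $\|\varphi\|_2=1$ and taken in their bounded continuous version. A ground state $\varphi_0$ is an eigenfunction at $\lambda_0=\inf\mathrm{Spec}\,H$ when $\lambda_0$ is an isolated eigenvalue; it is unique up to sign and chosen strictly positive. *)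

theory Defs
  imports "HOL-Probability.Probability"
begin

text \<open>
  Time is of type \<^typ>\<open>real\<close>; only times \<open>t \<ge> 0\<close> matter. All paths (not merely almost all) are
  cadlag, so that \<open>(s, \<omega>) \<mapsto> X s \<omega>\<close> is jointly measurable without completing \<open>M\<close>.
\<close>

definition levy_process :: "'w measure \<Rightarrow> (real \<Rightarrow> 'w \<Rightarrow> 'a::euclidean_space) \<Rightarrow> bool" where
  "levy_process M X \<longleftrightarrow>
     prob_space M \<and>
     (\<forall>t\<ge>0. X t \<in> borel_measurable M) \<and>
     (AE \<omega> in M. X 0 \<omega> = 0) \<and>
     (\<forall>(t :: nat \<Rightarrow> real) n. 0 \<le> t 0 \<and> incseq t \<longrightarrow>
        prob_space.indep_vars M (\<lambda>_. borel) (\<lambda>i \<omega>. X (t (Suc i)) \<omega> - X (t i) \<omega>) {..<n}) \<and>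
     (\<forall>s\<ge>0. \<forall>h\<ge>0. distr M borel (\<lambda>\<omega>. X (s + h) \<omega> - X s \<omega>) = distr M borel (X h)) \<and>
     (\<forall>\<omega>\<in>space M. \<forall>t\<ge>0.
        ((\<lambda>s. X s \<omega>) \<longlongrightarrow> X t \<omega>) (at_right t) \<and>
        (t > 0 \<longrightarrow> (\<exists>l. ((\<lambda>s. X s \<omega>) \<longlongrightarrow> l) (at_left t))))"

definition levy_measure :: "'a::euclidean_space measure \<Rightarrow> bool" where
  "levy_measure N \<longleftrightarrow>
     sets N = sets borel \<and> emeasure N {0} = 0 \<and>
     (\<integral>\<^sup>+z. ennreal (min 1 ((norm z)\<^sup>2)) \<partial>N) < \<infinity>"

definition levy_exponent :: "('a::euclidean_space \<Rightarrow> real) \<Rightarrow> 'a \<Rightarrow> real" where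
  "levy_exponent \<nu> \<xi> = (\<integral>z. (1 - cos (\<xi> \<bullet> z)) * \<nu> z \<partial>lborel)"

definition has_char_exponent ::
    "'w measure \<Rightarrow> (real \<Rightarrow> 'w \<Rightarrow> 'a::euclidean_space) \<Rightarrow> ('a \<Rightarrow> real) \<Rightarrow> bool" where
  "has_char_exponent M X \<psi> \<longleftrightarrow>
     (\<forall>t\<ge>0. \<forall>\<xi>. (CLINT \<omega>|M. iexp (\<xi> \<bullet> X t \<omega>)) = complex_of_real (exp (- (t * \<psi> \<xi>))))"

text \<open>
  The process started at \<open>x\<close> is \<open>x + X\<close>: an expectation under \<open>P\<^sup>x\<close> of a functional of
  the path is the integral over \<open>M\<close> of that functional of \<open>\<lambda>s. x + X s \<omega>\<close>.
\<close>

definition kato :: "'w measure \<Rightarrow> (real \<Rightarrow> 'w \<Rightarrow> 'a::euclidean_space) \<Rightarrow> ('a \<Rightarrow> real) \<Rightarrow> bool" where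
  "kato M X V \<longleftrightarrow>
     V \<in> borel_measurable borel \<and>
     ((\<lambda>t. SUP x. \<integral>\<^sup>+\<omega>. (\<integral>\<^sup>+s\<in>{0..t}. ennreal \<bar>V (x + X s \<omega>)\<bar> \<partial>lborel) \<partial>M) \<longlongrightarrow> 0)
       (at_right 0)"

definition kato_loc :: "'w measure \<Rightarrow> (real \<Rightarrow> 'w \<Rightarrow> 'a::euclidean_space) \<Rightarrow> ('a \<Rightarrow> real) \<Rightarrow> bool" where
  "kato_loc M X V \<longleftrightarrow> (\<forall>B. compact B \<longrightarrow> kato M X (\<lambda>x. V x * indicator B x))"

definition kato_decomposable ::
    "'w measure \<Rightarrow> (real \<Rightarrow> 'w \<Rightarrow> 'a::euclidean_space) \<Rightarrow> ('a \<Rightarrow> real) \<Rightarrow> bool" where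
  "kato_decomposable M X V \<longleftrightarrow>
     V \<in> borel_measurable borel \<and>
     kato M X (\<lambda>x. max 0 (- V x)) \<and> kato_loc M X (\<lambda>x. max 0 (V x))"

text \<open>
  \<open>L\<^sup>2\<close> is the real space, represented by functions rather than classes; equality in it is equality
  almost everywhere.
\<close>

definition L2 :: "('a::euclidean_space \<Rightarrow> real) set" where
  "L2 = {f \<in> borel_measurable lborel. integrable lborel (\<lambda>x. (f x)\<^sup>2)}"

text \<open>Extended-valued, so that convergence to \<open>0\<close> cannot come from a non-integrable integrand.\<close>

definition L2_dist_sq :: "('a::euclidean_space \<Rightarrow> real) \<Rightarrow> ('a \<Rightarrow> real) \<Rightarrow> ennreal" where
  "L2_dist_sq f g = (\<integral>\<^sup>+x. ennreal ((f x - g x)\<^sup>2) \<partial>lborel)"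

definition L2_norm :: "('a::euclidean_space \<Rightarrow> real) \<Rightarrow> real" where
  "L2_norm f = sqrt (\<integral>x. (f x)\<^sup>2 \<partial>lborel)"

definition feynman_kac ::
    "'w measure \<Rightarrow> (real \<Rightarrow> 'w \<Rightarrow> 'a::euclidean_space) \<Rightarrow> ('a \<Rightarrow> real) \<Rightarrow> real \<Rightarrow> ('a \<Rightarrow> real) \<Rightarrow> 'a \<Rightarrow> real" where
  "feynman_kac M X V t f x =
     (\<integral>\<omega>. exp (- (LINT s:{0..t}|lborel. V (x + X s \<omega>))) * f (x + X t \<omega>) \<partial>M)"

text \<open>
  The operator \<open>H\<close> with \<open>e\<^sup>-\<^sup>t\<^sup>H = T\<^sub>t\<close>, given by its graph: \<open>- H\<close> is the infinitesimal
  generator of the strongly continuous semigroup \<open>T\<^sub>t\<close> on \<open>L\<^sup>2\<close>.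
\<close>

definition schroedinger ::
    "'w measure \<Rightarrow> (real \<Rightarrow> 'w \<Rightarrow> 'a::euclidean_space) \<Rightarrow> ('a \<Rightarrow> real) \<Rightarrow> (('a \<Rightarrow> real) \<times> ('a \<Rightarrow> real)) set" where
  "schroedinger M X V =
     {(f, h). f \<in> L2 \<and> h \<in> L2 \<and>
        ((\<lambda>t. L2_dist_sq (\<lambda>x. (f x - feynman_kac M X V t f x) / t) h) \<longlongrightarrow> 0) (at_right 0)}"

text \<open>
  Resolvent set and spectrum of an operator on \<open>L\<^sup>2\<close> given by its graph \<open>G\<close>: \<open>\<mu>\<close> is in the resolvent
  set iff \<open>G - \<mu>\<close> is onto \<open>L\<^sup>2\<close> and has a bounded inverse (the bound includes injectivity). Only real
  \<open>\<mu>\<close> occur: the spectrum of a self-adjoint operator is real, and \<open>H\<close> maps real functions to real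
  functions, so its spectrum on real and on complex \<open>L\<^sup>2\<close> is the same.
\<close>

definition L2_resolvent_set :: "(('a::euclidean_space \<Rightarrow> real) \<times> ('a \<Rightarrow> real)) set \<Rightarrow> real set" where
  "L2_resolvent_set G =
     {\<mu>. (\<forall>k\<in>L2. \<exists>(f, h)\<in>G. AE x in lborel. h x - \<mu> * f x = k x) \<and>
         (\<exists>C. \<forall>(f, h)\<in>G. L2_norm f \<le> C * L2_norm (\<lambda>x. h x - \<mu> * f x))}"

definition L2_spectrum :: "(('a::euclidean_space \<Rightarrow> real) \<times> ('a \<Rightarrow> real)) set \<Rightarrow> real set" where
  "L2_spectrum G = - L2_resolvent_set G"

text \<open>Eigenfunctions are normalized and taken in their bounded continuous version.\<close>

definition eigenfunction ::
    "'w measure \<Rightarrow> (real \<Rightarrow> 'w \<Rightarrow> 'a::euclidean_space) \<Rightarrow> ('a \<Rightarrow> real) \<Rightarrow> real \<Rightarrow> ('a \<Rightarrow> real) \<Rightarrow> bool" where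
  "eigenfunction M X V \<mu> \<phi> \<longleftrightarrow>
     \<phi> \<in> L2 \<and> L2_norm \<phi> = 1 \<and> continuous_on UNIV \<phi> \<and> bounded (range \<phi>) \<and>
     (\<forall>t>0. AE x in lborel. feynman_kac M X V t \<phi> x = exp (- (\<mu> * t)) * \<phi> x)"

definition ground_state ::
    "'w measure \<Rightarrow> (real \<Rightarrow> 'w \<Rightarrow> 'a::euclidean_space) \<Rightarrow> ('a \<Rightarrow> real) \<Rightarrow> real \<Rightarrow> ('a \<Rightarrow> real) \<Rightarrow> bool" where
  "ground_state M X V \<mu> \<phi> \<longleftrightarrow>
     eigenfunction M X V \<mu> \<phi> \<and>
     \<mu> = Inf (L2_spectrum (schroedinger M X V)) \<and>
     \<mu> isolated_in L2_spectrum (schroedinger M X V) \<and>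
     (\<forall>x. \<phi> x > 0)"

end

theory Submission
  imports Defs
begin

text \<open>
  Since \<open>\<lambda>\<^sub>0 < 0\<close> is fixed and \<open>C\<^sub>3\<^sub>7\<close> may depend on it, \<open>sqrt (min (\<bar>\<lambda>\<^sub>0\<bar> + \<epsilon>) 1)\<close> is bounded below by
  \<open>sqrt (min \<bar>\<lambda>\<^sub>0\<bar> 1) > 0\<close> uniformly in \<open>\<epsilon>\<close>, and the logarithmic factor is at least \<open>1\<close> for large \<open>\<bar>x\<bar>\<close>. So
  an exponential lower bound \<open>C e\<^sup>-\<^sup>K\<^sup>\<bar>\<^sup>x\<^sup>\<bar>\<close> is enough. It comes from the eigenvalue equation
  at time \<open>1\<close>: far from the origin \<open>V \<le> 1\<close> along any path that stays in a bounded ball around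
  its starting point, and with a probability bounded below uniformly in \<open>x\<close> such a path ends up
  closer to the origin by a fixed amount. Hence \<open>\<phi>\<^sub>0(x)\<close> is at least a fixed fraction of the infimum
  of \<open>\<phi>\<^sub>0\<close> over a ball of radius \<open>\<bar>x\<bar> - b\<close>, and this is iterated down to a compact set. The
  uniform probability bound holds because \<open>X\<^sub>1\<close> is symmetric, and because \<open>E cos (e \<bullet> X\<^sub>1) = e\<^sup>-\<^sup>\<psi>\<^sup>(\<^sup>e\<^sup>)\<close>
  is less than \<open>1\<close> and continuous in \<open>e\<close> on the unit sphere.
\<close>

section \<open>Paths and the one-dimensional projections of the process\<close>

text \<open>The one-sided limits at a time \<open>t\<close> bound the path on a neighbourhood of
  \<open>t\<close>, and finitely many such neighbourhoods cover the compact interval.\<close>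

lemma cadlag_bounded:
  fixes f :: "real \<Rightarrow> 'b::real_normed_vector"
  assumes right: "\<And>t. 0 \<le> t \<Longrightarrow> (f \<longlongrightarrow> f t) (at_right t)"
    and left: "\<And>t. 0 < t \<Longrightarrow> \<exists>l. (f \<longlongrightarrow> l) (at_left t)"
  shows "bounded (f ` {0..T})"
proof -
  have tendsto_bound: "\<exists>C. \<forall>\<^sub>F s in F. norm (f s) \<le> C" if "(f \<longlongrightarrow> l) F" for l F
  proof -
    have "\<forall>\<^sub>F s in F. norm (f s) < norm l + 1"
      using tendsto_norm[OF that] by (rule order_tendstoD) simp
    then show ?thesis
      by (metis (mono_tags, lifting) eventually_mono less_imp_le)
  qed
  have "\<exists>C S. open S \<and> t \<in> S \<and> (\<forall>s\<in>S. 0 \<le> s \<longrightarrow> norm (f s) \<le> C)" if "0 \<le> t" for t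
  proof -
    obtain A where A: "\<forall>\<^sub>F s in at_right t. norm (f s) \<le> A"
      using tendsto_bound[OF right[OF \<open>0 \<le> t\<close>]] by blast
    \<comment> \<open>At time 0 no left limit is available. The guard \<open>0 \<le> s\<close> makes
      the claim vacuous to the left of 0, so that a two-sided neighbourhood can be used there as
      well.\<close>
    obtain B where B: "\<forall>\<^sub>F s in at_left t. 0 \<le> s \<longrightarrow> norm (f s) \<le> B"
    proof (cases "t = 0")
      case True
      have "\<forall>\<^sub>F s in at_left t. s < t"
        by (auto simp: eventually_at_filter)
      then have "\<forall>\<^sub>F s in at_left t. 0 \<le> s \<longrightarrow> norm (f s) \<le> 0"
        using True by (auto elim: eventually_mono)
      then show ?thesis
        by (rule that)
    next
      case False
      then obtain l where "(f \<longlongrightarrow> l) (at_left t)"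
        using left[of t] \<open>0 \<le> t\<close> by auto
      then obtain B where "\<forall>\<^sub>F s in at_left t. norm (f s) \<le> B"
        using tendsto_bound by blast
      then show ?thesis
        by (intro that) (auto elim: eventually_mono)
    qed
    define C where "C = max (norm (f t)) (max A B)"
    have "\<forall>\<^sub>F s in at t. 0 \<le> s \<longrightarrow> norm (f s) \<le> C"
      unfolding eventually_at_split using A B
      by (auto simp: C_def elim!: eventually_mono)
    then obtain S where "open S" "t \<in> S" "\<forall>s\<in>S. s \<noteq> t \<longrightarrow> 0 \<le> s \<longrightarrow> norm (f s) \<le> C"
      unfolding eventually_at_topological by auto
    moreover have "norm (f t) \<le> C"
      by (simp add: C_def)
    ultimately show ?thesis
      by metis
  qed
  then obtain C S where S: "\<And>t. 0 \<le> t \<Longrightarrow> open (S t) \<and> t \<in> S t"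
    and C: "\<And>t s. 0 \<le> t \<Longrightarrow> s \<in> S t \<Longrightarrow> 0 \<le> s \<Longrightarrow> norm (f s) \<le> C t"
    by metis
  obtain D where D: "D \<subseteq> {0..T}" "finite D" "{0..T} \<subseteq> (\<Union>t\<in>D. S t)"
    by (rule compactE_image[of "{0..T}" "{0..T}" S]) (use S in auto)
  have "norm (f s) \<le> (\<Sum>t\<in>D. \<bar>C t\<bar>)" if s: "s \<in> {0..T}" for s
  proof -
    obtain t where t: "t \<in> D" "s \<in> S t"
      using D s by blast
    have "norm (f s) \<le> \<bar>C t\<bar>"
      using C[of t s] t D s by force
    also have "\<dots> \<le> (\<Sum>t\<in>D. \<bar>C t\<bar>)"
      using t D by (intro member_le_sum) auto
    finally show ?thesis .
  qed
  then show ?thesis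
    unfolding bounded_iff by blast
qed

text \<open>
  By right continuity, the bound along a path only has to be imposed at countably many times; this
  makes the event measurable.
\<close>

lemma levy_process_bounded_paths:
  fixes X :: "real \<Rightarrow> 'w \<Rightarrow> 'a::euclidean_space"
  assumes levy: "levy_process M X" and "0 < p"
  shows "\<exists>r>0. \<exists>A\<in>sets M. 1 - p < measure M A \<and> (\<forall>\<omega>\<in>A. \<forall>s\<in>{0..1}. norm (X s \<omega>) \<le> r)"
proof -
  interpret prob_space M
    using levy by (simp add: levy_process_def)
  have meas [measurable]: "\<And>t. 0 \<le> t \<Longrightarrow> X t \<in> borel_measurable M"
    and right: "\<And>\<omega> t. \<omega> \<in> space M \<Longrightarrow> 0 \<le> t \<Longrightarrow> ((\<lambda>s. X s \<omega>) \<longlongrightarrow> X t \<omega>) (at_right t)"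
    and left: "\<And>\<omega> t. \<omega> \<in> space M \<Longrightarrow> 0 < t \<Longrightarrow> \<exists>l. ((\<lambda>s. X s \<omega>) \<longlongrightarrow> l) (at_left t)"
    using levy by (auto simp: levy_process_def)
  \<comment> \<open>The endpoint 1 is listed by name because it is not a limit from the right of
    times in \<open>{0..1}\<close>.\<close>
  define D :: "real set" where "D = insert 1 (\<rat> \<inter> {0..1})"
  have D: "countable D" "D \<subseteq> {0..1}"
    unfolding D_def by (auto simp: countable_rat)
  define A where "A k = {\<omega>\<in>space M. \<forall>s\<in>D. norm (X s \<omega>) \<le> real k}" for k
  have A_sets: "A k \<in> sets M" for k
  proof -
    have "{\<omega>\<in>space M. norm (X s \<omega>) \<le> real k} \<in> sets M" if "s \<in> D" for s
    proof -
      have [measurable]: "X s \<in> borel_measurable M"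
        using that D by (intro meas) auto
      show ?thesis by measurable
    qed
    then show ?thesis
      unfolding A_def using D(1) by (rule sets.sets_Collect_countable_All')
  qed
  have A_bound: "norm (X s \<omega>) \<le> real k" if A_s: "\<omega> \<in> A k" "s \<in> {0..1}" for \<omega> s k
  proof (cases "s = 1")
    case True
    then show ?thesis
      using that by (auto simp: A_def D_def)
  next
    case False
    have \<omega>: "\<omega> \<in> space M"
      using that by (auto simp: A_def)
    show ?thesis
    proof (rule ccontr)
      assume "\<not> ?thesis"
      then have "\<forall>\<^sub>F u in at_right s. real k < norm (X u \<omega>)"
        using that \<omega> by (intro order_tendstoD(1)[OF tendsto_norm[OF right]]) auto
      then obtain b where b: "s < b" "\<And>u. s < u \<Longrightarrow> u < b \<Longrightarrow> real k < norm (X u \<omega>)"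
        unfolding eventually_at_right_field by auto
      obtain u where u: "u \<in> \<rat>" "s < u" "u < min b 1"
        using Rats_dense_in_real[of s "min b 1"] b False A_s by auto
      then have "u \<in> D"
        using that by (auto simp: D_def)
      then show False
        using b(2)[of u] u that by (force simp: A_def)
    qed
  qed
  \<comment> \<open>Every path is bounded on \<open>{0..1}\<close>, so the events \<open>A k\<close>
    increase to the whole space and their probabilities tend to 1.\<close>
  have "incseq A"
    unfolding incseq_def A_def by (auto intro: order_trans)
  moreover have "(\<Union>k. A k) = space M"
  proof -
    have "\<exists>k. \<omega> \<in> A k" if \<omega>: "\<omega> \<in> space M" for \<omega>
    proof -
      have "bounded ((\<lambda>s. X s \<omega>) ` {0..1})"
        by (rule cadlag_bounded) (use \<omega> in \<open>auto intro: right left\<close>)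
      then obtain B where "\<forall>y\<in>(\<lambda>s. X s \<omega>) ` {0..1}. norm y \<le> B"
        unfolding bounded_iff by (rule exE)
      then have B: "norm (X s \<omega>) \<le> B" if "s \<in> {0..1}" for s
        using that by simp
      obtain k :: nat where "B \<le> real k"
        using real_arch_simple by blast
      then have "\<omega> \<in> A k"
        using B D \<omega> unfolding A_def by (blast intro: order_trans)
      then show ?thesis ..
    qed
    then show ?thesis
      by (auto simp: A_def)
  qed
  ultimately have "(\<lambda>k. prob (A k)) \<longlonglongrightarrow> 1"
    using finite_Lim_measure_incseq[of A] A_sets by (auto simp: prob_space)
  then have "\<forall>\<^sub>F k in sequentially. 1 - p < prob (A k)"
    using \<open>0 < p\<close> by (intro order_tendstoD(1)) auto
  then obtain k where k: "1 - p < prob (A k)"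
    by (auto simp: eventually_sequentially)
  \<comment> \<open>The radius is \<open>real k + 1\<close> since \<open>k\<close> may be 0 and the
    radius has to be positive.\<close>
  show ?thesis
    using k A_sets A_bound by (intro exI[of _ "real k + 1"] conjI bexI[of _ "A k"]) (force+)
qed

section \<open>Positivity of the characteristic exponent\<close>

lemma one_minus_cos_le: "1 - cos u \<le> u\<^sup>2 / 2" for u :: real
proof -
  have "(sin (u / 2))\<^sup>2 \<le> (u / 2)\<^sup>2"
    using abs_sin_x_le_abs_x[of "u / 2"] by (simp only: abs_le_square_iff)
  moreover have "cos u = 1 - 2 * (sin (u / 2))\<^sup>2"
    using cos_double_sin[of "u / 2"] by (simp only: mult_2 field_sum_of_halves)
  moreover have "2 * (u / 2)\<^sup>2 = u\<^sup>2 / 2"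
    by (simp add: power2_eq_square)
  ultimately show ?thesis
    by linarith
qed

text \<open>The integrand is nonnegative and vanishes almost nowhere on a nonempty open slab.
  Integrability has to be shown too, because the Bochner integral of a non-integrable function is
  0.\<close>

lemma levy_exponent_pos:
  fixes \<nu> :: "'a::euclidean_space \<Rightarrow> real"
  assumes [measurable]: "\<nu> \<in> borel_measurable borel"
    and levy: "levy_measure (density lborel (\<lambda>x. ennreal (\<nu> x)))"
    and pos: "\<And>x. x \<noteq> 0 \<Longrightarrow> 0 < \<nu> x"
    and "\<xi> \<noteq> 0"
  shows "0 < levy_exponent \<nu> \<xi>"
proof -
  define f where "f z = (1 - cos (\<xi> \<bullet> z)) * \<nu> z" for z
  have f_meas [measurable]: "f \<in> borel_measurable lborel"
    unfolding f_def by measurable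
  have f_nonneg: "0 \<le> f z" for z
    using pos[of z] by (cases "z = 0") (auto simp: f_def)
  \<comment> \<open>The summand 2 dominates \<open>1 - cos\<close> for large jumps, and
    \<open>(norm \<xi>)\<^sup>2\<close> dominates the quadratic bound for small ones.\<close>
  define K where "K = 2 + (norm \<xi>)\<^sup>2"
  have cos_bound: "1 - cos (\<xi> \<bullet> z) \<le> K * min 1 ((norm z)\<^sup>2)" for z
  proof (cases "norm z \<le> 1")
    case True
    have "1 - cos (\<xi> \<bullet> z) \<le> (\<xi> \<bullet> z)\<^sup>2"
      using one_minus_cos_le[of "\<xi> \<bullet> z"] zero_le_power2[of "\<xi> \<bullet> z"] by linarith
    also have "\<dots> \<le> (norm \<xi> * norm z)\<^sup>2"
      using Cauchy_Schwarz_ineq2[of \<xi> z] by (simp add: abs_le_square_iff[symmetric])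
    also have "\<dots> \<le> K * (norm z)\<^sup>2"
      by (simp add: K_def power_mult_distrib mult_right_mono)
    also have "\<dots> = K * min 1 ((norm z)\<^sup>2)"
      using True power_le_one[of "norm z" 2] by (simp add: min_absorb2)
    finally show ?thesis .
  next
    case False
    then have "min 1 ((norm z)\<^sup>2) = 1"
      by (simp add: min_def)
    moreover have "1 - cos (\<xi> \<bullet> z) \<le> 2"
      using cos_ge_minus_one[of "\<xi> \<bullet> z"] by linarith
    ultimately show ?thesis
      by (simp add: K_def add_increasing2)
  qed
  have K: "0 \<le> K"
    by (simp add: K_def)
  have "integrable lborel f"
  proof (rule integrableI_bounded)
    have "(\<integral>\<^sup>+z. ennreal (norm (f z)) \<partial>lborel)
        \<le> (\<integral>\<^sup>+z. ennreal K * (ennreal (\<nu> z) * ennreal (min 1 ((norm z)\<^sup>2))) \<partial>lborel)"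
    proof (rule nn_integral_mono)
      fix z :: 'a
      show "ennreal (norm (f z)) \<le> ennreal K * (ennreal (\<nu> z) * ennreal (min 1 ((norm z)\<^sup>2)))"
      proof (cases "z = 0")
        case False
        have "norm (f z) \<le> K * (\<nu> z * min 1 ((norm z)\<^sup>2))"
          using f_nonneg[of z] cos_bound[of z] pos[OF False]
          by (simp add: f_def mult_right_mono mult.assoc mult.left_commute mult.commute[of "\<nu> z"])
        then show ?thesis
          using pos[OF False] K
          by (simp add: ennreal_mult[symmetric] ennreal_leI)
      qed (simp add: f_def)
    qed
    also have "\<dots> = ennreal K * (\<integral>\<^sup>+z. ennreal (min 1 ((norm z)\<^sup>2)) \<partial>density lborel (\<lambda>x. ennreal (\<nu> x)))"
      by (simp add: nn_integral_cmult nn_integral_density)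
    also have "\<dots> < \<infinity>"
      using levy by (simp add: levy_measure_def ennreal_mult_less_top)
    finally show "(\<integral>\<^sup>+z. ennreal (norm (f z)) \<partial>lborel) < \<infinity>" .
  qed simp
  moreover have "\<not> (AE z in lborel. f z = 0)"
  proof
    assume "AE z in lborel. f z = 0"
    \<comment> \<open>On this slab the angle lies strictly between 0 and 2 < \<open>pi\<close>, so
      the cosine is less than 1. The slab omits the origin, where \<open>\<nu>\<close> need not be
      positive, and contains the multiple of \<open>\<xi>\<close> whose inner product with
      \<open>\<xi>\<close> is 1.\<close>
    define U where "U = {z::'a. \<xi> \<bullet> z \<in> {0<..<2}}"
    have "open U"
      unfolding U_def by (intro open_Collect_conj open_Collect_less continuous_intros
          | simp add: greaterThanLessThan_iff)+
    have "(1 / (norm \<xi>)\<^sup>2) *\<^sub>R \<xi> \<in> U"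
      using \<open>\<xi> \<noteq> 0\<close> by (simp add: U_def power2_norm_eq_inner)
    have "f z \<noteq> 0" if "z \<in> U" for z
    proof -
      have "cos (\<xi> \<bullet> z) < cos 0"
        using that pi_gt3 by (intro cos_monotone_0_pi) (auto simp: U_def)
      then show ?thesis
        using pos[of z] by (cases "z = 0") (auto simp: f_def)
    qed
    then have "AE z in lborel. z \<notin> U"
      using \<open>AE z in lborel. f z = 0\<close> by (auto elim!: eventually_mono)
    then have "U \<in> null_sets lborel"
      using \<open>open U\<close> by (subst AE_iff_null_sets) auto
    then have "negligible U"
      by (simp add: negligible_iff_null_sets null_sets_completionI)
    then show False
      using \<open>_ \<in> U\<close> open_not_negligible[OF \<open>open U\<close>] by blast
  qed
  ultimately have "integral\<^sup>L lborel f \<noteq> 0"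
    using f_nonneg by (subst integral_nonneg_eq_0_iff_AE) auto
  moreover have "0 \<le> integral\<^sup>L lborel f"
    using f_nonneg by (intro integral_nonneg_AE) auto
  ultimately show ?thesis
    by (simp add: levy_exponent_def flip: f_def)
qed

section \<open>Symmetry and uniform half-space probabilities\<close>

text \<open>The characteristic function of \<open>- Y\<close> is the complex conjugate of that of
  \<open>Y\<close>. If it is real the two agree, and characteristic functions determine
  distributions.\<close>

lemma (in prob_space) real_char_symmetric:
  fixes Y :: "'a \<Rightarrow> real"
  assumes [measurable]: "Y \<in> borel_measurable M"
    and real: "\<And>t. (CLINT \<omega>|M. iexp (t * Y \<omega>)) \<in> \<real>"
  shows "distr M borel (\<lambda>\<omega>. - Y \<omega>) = distr M borel Y"
proof (rule Levy_uniqueness)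
  show "char (distr M borel (\<lambda>\<omega>. - Y \<omega>)) = char (distr M borel Y)"
  proof
    fix t
    have "char (distr M borel (\<lambda>\<omega>. - Y \<omega>)) t = (CLINT \<omega>|M. cnj (iexp (t * Y \<omega>)))"
      unfolding char_def by (subst integral_distr) (auto simp: exp_cnj)
    also have "\<dots> = cnj (CLINT \<omega>|M. iexp (t * Y \<omega>))"
      by (rule Bochner_Integration.integral_cnj)
    also have "\<dots> = (CLINT \<omega>|M. iexp (t * Y \<omega>))"
      using real[of t] by (simp add: Reals_cnj_iff)
    also have "\<dots> = char (distr M borel Y) t"
      unfolding char_def by (subst integral_distr) auto
    finally show "char (distr M borel (\<lambda>\<omega>. - Y \<omega>)) t = char (distr M borel Y) t" .
  qed
qed (auto intro!: real_distribution_distr)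

text \<open>The expectation of \<open>1 - cos (e \<bullet> Z)\<close> has a positive minimum over
  the unit sphere. Small values of \<open>e \<bullet> Z\<close> cannot account for all of it, so the
  two tails carry mass, and by symmetry each carries half.\<close>

lemma (in prob_space) halfspace_prob_uniform:
  fixes Z :: "'a \<Rightarrow> 'b::euclidean_space"
  assumes [measurable]: "Z \<in> borel_measurable M"
    and char: "\<And>\<xi>. (CLINT \<omega>|M. iexp (\<xi> \<bullet> Z \<omega>)) = complex_of_real (exp (- \<psi> \<xi>))"
    and pos: "\<And>\<xi>. \<xi> \<noteq> 0 \<Longrightarrow> 0 < \<psi> \<xi>"
  obtains a p where "0 < a" "0 < p"
    and "\<And>e. norm e = 1 \<Longrightarrow> p \<le> prob {\<omega>\<in>space M. e \<bullet> Z \<omega> < - a}"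
proof -
  define h where "h e = expectation (\<lambda>\<omega>. 1 - cos (e \<bullet> Z \<omega>))" for e
  have int_cos: "integrable M (\<lambda>\<omega>. cos (e \<bullet> Z \<omega>))" for e
    by (rule integrable_const_bound[where B = 1]) auto
  have h_pos: "0 < h e" if "norm e = 1" for e
  proof -
    have int: "integrable M (\<lambda>\<omega>. iexp (e \<bullet> Z \<omega>))"
      by (rule integrable_const_bound[where B = 1]) auto
    have "expectation (\<lambda>\<omega>. cos (e \<bullet> Z \<omega>)) = expectation (\<lambda>\<omega>. Re (iexp (e \<bullet> Z \<omega>)))"
      by (simp add: Re_exp)
    also have "\<dots> = exp (- \<psi> e)"
      using int char[of e] by (subst integral_Re) auto
    finally have "expectation (\<lambda>\<omega>. cos (e \<bullet> Z \<omega>)) = exp (- \<psi> e)" .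
    moreover have "0 < \<psi> e"
      using that by (intro pos) auto
    ultimately show ?thesis
      using int_cos by (simp add: h_def prob_space)
  qed
  have "continuous_on (sphere 0 1) h"
    unfolding continuous_on_sequentially h_def comp_def
  proof (intro allI impI ballI)
    fix x :: "nat \<Rightarrow> 'b" and a :: 'b
    assume *: "a \<in> sphere 0 1" "(\<forall>n. x n \<in> sphere 0 1) \<and> x \<longlonglongrightarrow> a"
    show "(\<lambda>n. expectation (\<lambda>\<omega>. 1 - cos (x n \<bullet> Z \<omega>))) \<longlonglongrightarrow> expectation (\<lambda>\<omega>. 1 - cos (a \<bullet> Z \<omega>))"
    proof (rule integral_dominated_convergence[where w = "\<lambda>_. 2"])
      show "AE \<omega> in M. (\<lambda>n. 1 - cos (x n \<bullet> Z \<omega>)) \<longlonglongrightarrow> 1 - cos (a \<bullet> Z \<omega>)"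
        using * by (auto intro!: tendsto_intros)
      show "AE \<omega> in M. norm (1 - cos (x n \<bullet> Z \<omega>)) \<le> 2" for n
      proof (rule AE_I2)
        fix \<omega>
        show "norm (1 - cos (x n \<bullet> Z \<omega>)) \<le> 2"
          using cos_ge_minus_one[of "x n \<bullet> Z \<omega>"] cos_le_one[of "x n \<bullet> Z \<omega>"]
          unfolding real_norm_def by linarith
      qed
    qed auto
  qed
  then obtain e0 where e0: "e0 \<in> sphere 0 (1::real)" "\<And>e. e \<in> sphere 0 1 \<Longrightarrow> h e0 \<le> h e"
    using continuous_attains_inf[of "sphere (0::'b) 1" h] by (auto simp: compact_sphere)
  define p where "p = h e0"
  have p: "0 < p"
    using h_pos e0 by (simp add: p_def)
  \<comment> \<open>With this threshold the values at most \<open>a\<close> in modulus contribute at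
    most \<open>a\<^sup>2 / 2\<close>, which is \<open>p / 2\<close>. Each tail contributes at most
    twice its probability, so \<open>p / 2\<close> is at most four times one tail; hence the bound
    \<open>p / 8\<close>.\<close>
  define a where "a = sqrt p"
  have a: "0 < a" "a\<^sup>2 = p"
    using p by (simp_all add: a_def)
  have "p / 8 \<le> prob {\<omega>\<in>space M. e \<bullet> Z \<omega> < - a}" if e: "norm e = 1" for e
  proof -
    define N where "N = {\<omega>\<in>space M. e \<bullet> Z \<omega> < - a}"
    define P where "P = {\<omega>\<in>space M. - (e \<bullet> Z \<omega>) < - a}"
    have [measurable]: "N \<in> sets M" "P \<in> sets M"
      unfolding N_def P_def by measurable
    \<comment> \<open>The characteristic function of the projection onto \<open>e\<close> is that of
      \<open>Z\<close> along the line through \<open>e\<close>, which is real by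
      \<open>char\<close>.\<close>
    have "(CLINT \<omega>|M. iexp (t * (e \<bullet> Z \<omega>))) \<in> \<real>" for t
      using char[of "t *\<^sub>R e"] by simp
    then have "measure (distr M borel (\<lambda>\<omega>. - (e \<bullet> Z \<omega>))) {..<-a} = measure (distr M borel (\<lambda>\<omega>. e \<bullet> Z \<omega>)) {..<-a}"
      by (subst real_char_symmetric) auto
    then have sym: "prob P = prob N"
      by (simp add: measure_distr vimage_def Int_def N_def P_def conj_commute)
    have "p \<le> h e"
      using e e0 by (simp add: p_def)
    also have "h e \<le> expectation (\<lambda>\<omega>. a\<^sup>2 / 2 + 2 * indicator N \<omega> + 2 * indicator P \<omega>)"
      unfolding h_def
    proof (rule integral_mono)
      show "integrable M (\<lambda>\<omega>. 1 - cos (e \<bullet> Z \<omega>))"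
        using int_cos by simp
      show "integrable M (\<lambda>\<omega>. a\<^sup>2 / 2 + 2 * indicator N \<omega> + 2 * indicator P \<omega> :: real)"
        by (intro Bochner_Integration.integrable_add integrable_mult_right) (auto simp: emeasure_eq_measure)
      fix \<omega> assume \<omega>: "\<omega> \<in> space M"
      show "1 - cos (e \<bullet> Z \<omega>) \<le> a\<^sup>2 / 2 + 2 * indicator N \<omega> + 2 * indicator P \<omega>"
      proof (cases "\<bar>e \<bullet> Z \<omega>\<bar> \<le> a")
        case True
        have "1 - cos (e \<bullet> Z \<omega>) \<le> (e \<bullet> Z \<omega>)\<^sup>2 / 2"
          by (rule one_minus_cos_le)
        also have "\<dots> \<le> a\<^sup>2 / 2"
          using True by (simp add: abs_le_square_iff[symmetric])
        finally show ?thesis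
          by (simp add: indicator_def)
      next
        case False
        then have "\<omega> \<in> N \<or> \<omega> \<in> P"
          using \<omega> by (auto simp: N_def P_def)
        moreover have "1 - cos (e \<bullet> Z \<omega>) \<le> 2"
          using cos_ge_minus_one[of "e \<bullet> Z \<omega>"] by linarith
        ultimately show ?thesis
          by (auto simp: indicator_def add_increasing)
      qed
    qed
    also have "\<dots> = p / 2 + 2 * prob N + 2 * prob P"
      by (simp add: a prob_space emeasure_eq_measure)
    finally show ?thesis
      using sym by (simp add: N_def)
  qed
  moreover have "0 < p / 8"
    using p by simp
  ultimately show thesis
    using a that by blast
qed

section \<open>Moving towards the origin\<close>

text \<open>In the expansion of the squared norm the inner product gains
  \<open>2 * a * norm x\<close>, and the quadratic term costs at most half of that once
  \<open>x\<close> is far out. The condition \<open>a \<le> norm x\<close> keeps the right-hand side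
  nonnegative, so that squares can be compared.\<close>

lemma norm_add_towards_origin:
  fixes x y :: "'a::euclidean_space"
  assumes "x \<bullet> y \<le> - a * norm x" "norm y \<le> r" "0 < a" "r\<^sup>2 \<le> a * norm x" "a \<le> norm x"
  shows "norm (x + y) \<le> norm x - a / 2"
proof (rule power2_le_imp_le)
  have "(norm (x + y))\<^sup>2 = (norm x)\<^sup>2 + 2 * (x \<bullet> y) + (norm y)\<^sup>2"
    by (simp add: power2_norm_eq_inner inner_add inner_commute)
  also have "\<dots> \<le> (norm x)\<^sup>2 + 2 * (- a * norm x) + r\<^sup>2"
    using assms by (intro add_mono mult_left_mono power_mono) auto
  also have "\<dots> \<le> (norm x - a / 2)\<^sup>2"
    using assms(4) by (simp add: power2_diff power_divide add_increasing2)
  finally show "(norm (x + y))\<^sup>2 \<le> (norm x - a / 2)\<^sup>2" .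
qed (use assms in auto)

text \<open>
  A Bochner integral that does not exist is \<open>0\<close>, so neither integrability nor measurability of the
  integrand is needed.
\<close>

lemma set_integral_le_on_unit_interval:
  fixes f :: "real \<Rightarrow> real"
  assumes "\<And>s. s \<in> {0..1} \<Longrightarrow> f s \<le> 1"
  shows "(LINT s:{0..1}|lborel. f s) \<le> 1"
proof (cases "set_integrable lborel {0..1} f")
  case True
  then have "integrable lborel (\<lambda>s. indicator {0..1} s *\<^sub>R f s)"
    by (simp add: set_integrable_def)
  then have "(LINT s:{0..1}|lborel. f s) \<le> (\<integral>s. indicator {0..1::real} s \<partial>lborel)"
    unfolding set_lebesgue_integral_def using assms
    by (intro integral_mono) (auto split: split_indicator)
  then show ?thesis
    by simp
next
  case False
  then show ?thesis
    by (simp add: set_lebesgue_integral_def set_integrable_def not_integrable_integral_eq)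
qed

text \<open>The expectation is restricted to paths that stay near their starting point, where
  \<open>V\<close> is at most 1, and that end closer to the origin. The condition that the
  Feynman-Kac value is nonzero stands in for integrability, since an integral that does not exist is
  0; for a positive eigenfunction the eigenvalue equation supplies it.\<close>

lemma feynman_kac_one_step:
  fixes X :: "real \<Rightarrow> 'w \<Rightarrow> 'a::euclidean_space"
  assumes levy: "levy_process M X"
    and char: "has_char_exponent M X \<psi>"
    and pos: "\<And>\<xi>. \<xi> \<noteq> 0 \<Longrightarrow> 0 < \<psi> \<xi>"
    and V: "(V \<longlongrightarrow> 0) at_infinity"
  obtains b q R where "0 < b" "0 < q" "0 < R"
    and "\<And>x f m. R \<le> norm x \<Longrightarrow> \<forall>y. 0 \<le> f y \<Longrightarrow> feynman_kac M X V 1 f x \<noteq> 0 \<Longrightarrow> 0 \<le> m \<Longrightarrow>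
      \<forall>y. norm y \<le> norm x - b \<longrightarrow> m \<le> f y \<Longrightarrow> q * m \<le> feynman_kac M X V 1 f x"
proof -
  interpret prob_space M
    using levy by (simp add: levy_process_def)
  have [measurable]: "X 1 \<in> borel_measurable M"
    using levy by (simp add: levy_process_def)
  have "(CLINT \<omega>|M. iexp (\<xi> \<bullet> X 1 \<omega>)) = complex_of_real (exp (- \<psi> \<xi>))" for \<xi>
    using char[unfolded has_char_exponent_def, rule_format, of 1 \<xi>] by simp
  then obtain a p where a: "0 < a" and p: "0 < p"
    and half: "\<And>e. norm e = 1 \<Longrightarrow> p \<le> prob {\<omega>\<in>space M. e \<bullet> X 1 \<omega> < - a}"
    using halfspace_prob_uniform[of "X 1" \<psi>, OF _ _ pos] by auto
  obtain r A where r: "0 < r" and A [measurable]: "A \<in> sets M" and prob_A: "1 - p / 2 < prob A"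
    and path: "\<And>\<omega> s. \<omega> \<in> A \<Longrightarrow> s \<in> {0..1} \<Longrightarrow> norm (X s \<omega>) \<le> r"
    using levy_process_bounded_paths[OF levy, of "p / 2"] p by auto
  have "\<forall>\<^sub>F x in at_infinity. V x < 1"
    using V by (rule order_tendstoD) simp
  then obtain R0 where R0: "\<And>x. R0 \<le> norm x \<Longrightarrow> V x < 1"
    by (auto simp: eventually_at_infinity)
  \<comment> \<open>The first entry gives \<open>a \<le> norm x\<close> and
    \<open>r\<^sup>2 \<le> a * norm x\<close>, as the geometric estimate requires. The second keeps
    a path of range \<open>r\<close> outside the ball of radius \<open>R0\<close>.\<close>
  define R where "R = max (a + r\<^sup>2 / a) (r + \<bar>R0\<bar>)"
  have "0 < R"
    using r by (simp add: R_def less_max_iff_disj add_pos_nonneg)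
  \<comment> \<open>The factor \<open>exp (- 1)\<close> bounds the Feynman-Kac weight from below,
    and \<open>p / 2\<close> the probability of the good event.\<close>
  define q where "q = exp (- 1) * (p / 2)"
  have "0 < q"
    using p by (simp add: q_def)
  have step: "q * m \<le> feynman_kac M X V 1 f x"
    if x: "R \<le> norm x" and f: "\<forall>y. 0 \<le> f y" and fk: "feynman_kac M X V 1 f x \<noteq> 0" and m: "0 \<le> m"
      and below: "\<forall>y. norm y \<le> norm x - a / 2 \<longrightarrow> m \<le> f y" for x f m
  proof -
    define F where "F \<omega> = exp (- (LINT s:{0..1}|lborel. V (x + X s \<omega>))) * f (x + X 1 \<omega>)" for \<omega>
    have fk_eq: "feynman_kac M X V 1 f x = expectation F"
      unfolding feynman_kac_def F_def ..
    have F_int: "integrable M F"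
      using fk unfolding fk_eq by (rule contrapos_np) (simp add: not_integrable_integral_eq)
    define e where "e = (1 / norm x) *\<^sub>R x"
    have x_pos: "0 < norm x"
      using x \<open>0 < R\<close> by linarith
    have e: "norm e = 1"
      using x_pos by (simp add: e_def)
    \<comment> \<open>The half-space event has probability at least \<open>p\<close>, and
      \<open>A\<close> misses less than \<open>p / 2\<close>, so at least \<open>p / 2\<close>
      remains.\<close>
    define B where "B = {\<omega>\<in>space M. e \<bullet> X 1 \<omega> < - a} \<inter> A"
    have [measurable]: "B \<in> sets M"
      unfolding B_def by measurable
    have "p / 2 \<le> prob B"
    proof -
      have "prob {\<omega>\<in>space M. e \<bullet> X 1 \<omega> < - a} \<le> prob (B \<union> (space M - A))"
        by (rule finite_measure_mono) (auto simp: B_def)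
      also have "\<dots> \<le> prob B + prob (space M - A)"
        by (rule measure_subadditive) (auto simp: emeasure_eq_measure)
      also have "prob (space M - A) = 1 - prob A"
        by (rule prob_compl) simp
      finally show ?thesis
        using half[OF e] prob_A by linarith
    qed
    then have "q * m \<le> expectation (\<lambda>\<omega>. exp (- 1) * m * indicator B \<omega>)"
      using mult_left_mono[of "p / 2" "prob B" "exp (- 1) * m"] m by (simp add: q_def mult_ac)
    also have "\<dots> \<le> expectation F"
    proof (rule integral_mono[OF _ F_int])
      show "integrable M (\<lambda>\<omega>. exp (- 1) * m * indicator B \<omega> :: real)"
        by (intro integrable_mult_right) (auto simp: emeasure_eq_measure)
      fix \<omega> assume "\<omega> \<in> space M"
      show "exp (- 1) * m * indicator B \<omega> \<le> F \<omega>"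
      proof (cases "\<omega> \<in> B")
        case True
        have "V (x + X s \<omega>) \<le> 1" if "s \<in> {0..1}" for s
        proof -
          have "norm x - norm (X s \<omega>) \<le> norm (x + X s \<omega>)"
            using norm_diff_ineq by blast
          then have "R0 \<le> norm (x + X s \<omega>)"
            using path[of \<omega> s] that True x by (auto simp: B_def R_def)
          then show ?thesis
            using R0 by (simp add: less_imp_le)
        qed
        then have "exp (- 1) \<le> exp (- (LINT s:{0..1}|lborel. V (x + X s \<omega>)))"
          using set_integral_le_on_unit_interval[of "\<lambda>s. V (x + X s \<omega>)"] by simp
        moreover have "norm (x + X 1 \<omega>) \<le> norm x - a / 2"
        proof (rule norm_add_towards_origin)
          show "x \<bullet> X 1 \<omega> \<le> - a * norm x"
            using True x_pos by (auto simp: B_def e_def field_simps)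
          show "norm (X 1 \<omega>) \<le> r"
            using True by (intro path) (auto simp: B_def)
          have "a + r\<^sup>2 / a \<le> norm x"
            using x by (simp add: R_def)
          moreover have "0 \<le> r\<^sup>2 / a"
            using a by simp
          ultimately have "a \<le> norm x" and "r\<^sup>2 / a \<le> norm x"
            using a by linarith+
          then show "a \<le> norm x" and "r\<^sup>2 \<le> a * norm x"
            using a by (simp_all add: pos_divide_le_eq mult.commute)
        qed (rule a)
        ultimately have "exp (- 1) * m \<le> F \<omega>"
          unfolding F_def using m by (intro mult_mono below[rule_format]) auto
        then show ?thesis
          using True by simp
      next
        case False
        then show ?thesis
          using f by (simp add: F_def)
      qed
    qed
    finally show ?thesis
      unfolding fk_eq .
  qed
  show thesis
  proof (rule that[of "a / 2" q R])
    show "0 < a / 2"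
      using a by simp
  qed (fact \<open>0 < q\<close> \<open>0 < R\<close> step)+
qed

section \<open>Iteration of the eigenvalue equation\<close>

text \<open>The points of \<open>U\<close> violating the bound form an open null set, which is
  empty. This turns consequences of the eigenvalue equation, known only almost everywhere, into
  pointwise bounds.\<close>

lemma AE_ge_imp_ge_on_open:
  fixes f :: "'a::euclidean_space \<Rightarrow> real"
  assumes "continuous_on UNIV f" "open U" and AE: "AE x in lborel. x \<in> U \<longrightarrow> c \<le> f x" and "x \<in> U"
  shows "c \<le> f x"
proof -
  define W where "W = U \<inter> {x. f x < c}"
  have "open W"
    unfolding W_def using assms by (intro open_Int open_Collect_less) (auto intro: continuous_intros)
  have "AE x in lborel. x \<notin> W"
    using AE by (auto simp: W_def elim!: eventually_mono)
  then have "W \<in> null_sets lborel"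
    using \<open>open W\<close> by (subst AE_iff_null_sets) auto
  then have "negligible W"
    by (simp add: negligible_iff_null_sets null_sets_completionI)
  then have "W = {}"
    using open_not_negligible[OF \<open>open W\<close>] by blast
  then show ?thesis
    using \<open>x \<in> U\<close> by (force simp: W_def)
qed

text \<open>Each use of the one-step bound enlarges the ball with a known lower bound by
  \<open>b\<close> in radius and costs a factor \<open>\<rho>\<close>. About
  \<open>norm x / b\<close> uses reach \<open>x\<close>, which gives exponential decay.\<close>

lemma positive_eigenfunction_exponential_lower_bound:
  fixes X :: "real \<Rightarrow> 'w \<Rightarrow> 'a::euclidean_space"
  assumes "levy_process M X" "has_char_exponent M X \<psi>"
    and "\<And>\<xi>. \<xi> \<noteq> 0 \<Longrightarrow> 0 < \<psi> \<xi>" and "(V \<longlongrightarrow> 0) at_infinity"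
    and eigen: "eigenfunction M X V \<mu> \<phi>" and pos: "\<And>x. 0 < \<phi> x"
  obtains C K where "0 < C" "0 < K" "\<And>x. C * exp (- (K * norm x)) \<le> \<phi> x"
proof -
  obtain b q R where b: "0 < b" and q: "0 < q" and R: "0 < R"
    and step: "\<And>x f m. R \<le> norm x \<Longrightarrow> \<forall>y. 0 \<le> f y \<Longrightarrow> feynman_kac M X V 1 f x \<noteq> 0 \<Longrightarrow> 0 \<le> m \<Longrightarrow>
      \<forall>y. norm y \<le> norm x - b \<longrightarrow> m \<le> f y \<Longrightarrow> q * m \<le> feynman_kac M X V 1 f x"
    using feynman_kac_one_step[OF assms(1-4)] by metis
  have cont: "continuous_on UNIV \<phi>"
    and AE: "AE x in lborel. feynman_kac M X V 1 \<phi> x = exp (- \<mu>) * \<phi> x"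
    using eigen by (auto simp: eigenfunction_def dest!: spec[of _ "1::real"])
  \<comment> \<open>Solving the eigenvalue equation for \<open>\<phi>\<close> turns the factor
    \<open>q\<close> into \<open>q * exp \<mu>\<close>. The cap at \<open>1 / 2\<close> forces
    \<open>\<rho> < 1\<close>, so that the powers decrease and \<open>ln \<rho>\<close> is
    negative.\<close>
  define \<rho> where "\<rho> = min (q * exp \<mu>) (1 / 2)"
  have \<rho>: "0 < \<rho>" "\<rho> < 1" "\<rho> \<le> q * exp \<mu>"
    using q by (auto simp: \<rho>_def)
  have "\<exists>x0\<in>cball 0 R. \<forall>x\<in>cball 0 R. \<phi> x0 \<le> \<phi> x"
    using R by (intro continuous_attains_inf continuous_on_subset[OF cont]) auto
  then obtain x0 where "\<forall>x\<in>cball 0 R. \<phi> x0 \<le> \<phi> x"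
    by (rule bexE)
  then have x0: "\<phi> x0 \<le> \<phi> x" if "norm x \<le> R" for x
    using that by simp
  define m where "m = \<phi> x0"
  have m: "0 < m"
    using pos by (simp add: m_def)
  \<comment> \<open>The strict inequality makes the region an open ball, as needed to pass from
    almost every point to every point.\<close>
  have iterate: "\<rho> ^ n * m \<le> \<phi> x" if "norm x < R + real n * b" for n x
    using that
  proof (induction n arbitrary: x)
    case 0
    then show ?case
      using x0 by (simp add: m_def)
  next
    case (Suc n)
    have "AE y in lborel. y \<in> ball 0 (R + real (Suc n) * b) \<longrightarrow> \<rho> ^ Suc n * m \<le> \<phi> y"
      using AE
    proof (rule eventually_mono, intro impI)
      fix y :: 'a
      assume eq: "feynman_kac M X V 1 \<phi> y = exp (- \<mu>) * \<phi> y" and "y \<in> ball 0 (R + real (Suc n) * b)"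
      then have y: "norm y < R + real n * b + b"
        by (simp add: algebra_simps)
      show "\<rho> ^ Suc n * m \<le> \<phi> y"
      proof (cases "norm y < R")
        case True
        have "\<rho> ^ Suc n * m \<le> 1 * m"
          using \<rho> m by (intro mult_right_mono power_le_one) auto
        then show ?thesis
          using x0[of y] True by (simp add: m_def)
      next
        case False
        have "q * (\<rho> ^ n * m) \<le> feynman_kac M X V 1 \<phi> y"
          using False y \<rho> m pos Suc.IH by (intro step) (auto simp: eq less_imp_le less_imp_neq[symmetric])
        then have "exp \<mu> * (q * (\<rho> ^ n * m)) \<le> exp \<mu> * (exp (- \<mu>) * \<phi> y)"
          unfolding eq by (intro mult_left_mono) auto
        also have "\<dots> = \<phi> y"
          by (simp add: exp_minus)
        finally have "(q * exp \<mu>) * (\<rho> ^ n * m) \<le> \<phi> y"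
          by (simp add: mult_ac)
        moreover have "\<rho> * (\<rho> ^ n * m) \<le> (q * exp \<mu>) * (\<rho> ^ n * m)"
          using \<rho> m by (intro mult_right_mono) auto
        ultimately show ?thesis
          by (simp add: mult.assoc)
      qed
    qed
    from AE_ge_imp_ge_on_open[OF cont open_ball this, of x] show ?case
      using Suc.prems by simp
  qed
  \<comment> \<open>This is the rate with \<open>\<rho> = exp (- (K * b))\<close>.\<close>
  define K where "K = - ln \<rho> / b"
  have K: "0 < K"
    using \<rho> b by (simp add: K_def divide_neg_pos ln_less_zero)
  have "\<rho> * m * exp (- (K * norm x)) \<le> \<phi> x" for x
  proof -
    \<comment> \<open>Rounding up costs at most one more factor \<open>\<rho>\<close>, which is
      absorbed into the constant. The strict inequality required by \<open>iterate\<close> comes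
      from \<open>R > 0\<close>.\<close>
    define n where "n = nat \<lceil>norm x / b\<rceil>"
    have n: "norm x / b \<le> real n" "real n \<le> norm x / b + 1"
      using b by (auto simp: n_def)
    have "\<rho> * exp (- (K * norm x)) = \<rho> powr (norm x / b + 1)"
      using \<rho> by (simp add: powr_add) (simp add: powr_def K_def mult.commute)
    also have "\<dots> \<le> \<rho> powr real n"
      using \<rho> n by (intro powr_mono') auto
    also have "\<dots> = \<rho> ^ n"
      using \<rho> by (simp add: powr_realpow)
    finally have "\<rho> * exp (- (K * norm x)) * m \<le> \<rho> ^ n * m"
      using m by (intro mult_right_mono) auto
    moreover have "norm x < R + real n * b"
      using n b R by (simp add: field_simps)
    ultimately show ?thesis
      using iterate[of x n] by (simp add: mult_ac)
  qed
  moreover have "0 < \<rho> * m"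
    using \<rho> m by simp
  ultimately show thesis
    using K that by blast
qed

theorem corollary4p4:
  fixes M :: "'w measure"
    and X :: "real \<Rightarrow> 'w \<Rightarrow> 'a::euclidean_space"
    and \<nu> :: "'a \<Rightarrow> real"
    and g :: "real \<Rightarrow> real"
    and V \<phi>\<^sub>0 :: "'a \<Rightarrow> real"
    and C20 C21 C26 C27 \<gamma> c \<beta> \<delta> lam0 :: real
  assumes "levy_process M X"
    and "has_char_exponent M X (levy_exponent \<nu>)"
    and "\<nu> \<in> borel_measurable borel"
    and "levy_measure (density lborel (\<lambda>x. ennreal (\<nu> x)))"
    and "emeasure (density lborel (\<lambda>x. ennreal (\<nu> x))) (UNIV - {0}) = \<infinity>"
    and "\<And>x. \<nu> (- x) = \<nu> x"
    and "\<And>r. r > 0 \<Longrightarrow> g r > 0"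
    and "antimono_on {0<..} g"
    and "0 < C26" "C26 \<le> 1" "1 \<le> C27"
    and "\<And>x. x \<noteq> 0 \<Longrightarrow> C26 * g (norm x) \<le> \<nu> x"
    and "\<And>x. x \<noteq> 0 \<Longrightarrow> \<nu> x \<le> C27 * g (norm x)"
    and "0 < \<gamma>" "\<gamma> < 2" "0 < C20" "0 < C21"
    and "\<And>l r. 0 < l \<Longrightarrow> l \<le> 1 \<Longrightarrow> 0 < r \<Longrightarrow> r \<le> 1 \<Longrightarrow>
           C20 * l powr (- real DIM('a) - \<gamma>) * g r \<le> g (l * r)"
    and "\<And>l r. 0 < l \<Longrightarrow> l \<le> 1 \<Longrightarrow> 0 < r \<Longrightarrow> r \<le> 1 \<Longrightarrow>
           g (l * r) \<le> C21 * l powr (- real DIM('a) - \<gamma>) * g r"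
    and "0 < c" "1 < \<beta>" "0 \<le> \<delta>"
    and "\<And>r. 1 \<le> r \<Longrightarrow> g r = exp (- (c * r powr \<beta>)) * r powr (- \<delta>)"
    and "kato_decomposable M X V"
    and "(V \<longlongrightarrow> 0) at_infinity"
    and "ground_state M X V lam0 \<phi>\<^sub>0"
    and "lam0 < 0"
  shows "\<exists>C37>0. \<forall>\<epsilon>>0. \<exists>C38>0. \<exists>R>0. \<forall>x. norm x \<ge> R \<longrightarrow>
           \<phi>\<^sub>0 x \<ge> C38 * exp (- (C37 * sqrt (min (\<bar>lam0\<bar> + \<epsilon>) 1) * norm x
                                 * (ln (norm x)) powr ((\<beta> - 1) / \<beta>)))"
proof -
  have \<psi>_pos: "0 < levy_exponent \<nu> \<xi>" if "\<xi> \<noteq> 0" for \<xi>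
  proof (rule levy_exponent_pos[OF assms(3,4) _ that])
    fix x :: 'a assume "x \<noteq> 0"
    then have "0 < C26 * g (norm x)"
      using assms(7) \<open>0 < C26\<close> by simp
    also have "\<dots> \<le> \<nu> x"
      using \<open>x \<noteq> 0\<close> by (rule assms(12))
    finally show "0 < \<nu> x" .
  qed
  have eigen: "eigenfunction M X V lam0 \<phi>\<^sub>0" and pos: "\<And>x. 0 < \<phi>\<^sub>0 x"
    using \<open>ground_state M X V lam0 \<phi>\<^sub>0\<close> by (auto simp: ground_state_def)
  obtain C K where C: "0 < C" and K: "0 < K"
    and bound: "\<And>x. C * exp (- (K * norm x)) \<le> \<phi>\<^sub>0 x"
    using positive_eigenfunction_exponential_lower_bound
      [OF assms(1,2) \<psi>_pos \<open>(V \<longlongrightarrow> 0) at_infinity\<close> eigen pos]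
    by blast
  define \<sigma> where "\<sigma> = sqrt (min \<bar>lam0\<bar> 1)"
  have \<sigma>: "0 < \<sigma>"
    using \<open>lam0 < 0\<close> by (simp add: \<sigma>_def)
  \<comment> \<open>The radius \<open>exp 1\<close> makes the logarithm at least 1, and then its
    power with nonnegative exponent as well. Division by \<open>\<sigma>\<close> compensates the
    square root for all \<open>\<epsilon>\<close> at once.\<close>
  have "C * exp (- (K / \<sigma> * sqrt (min (\<bar>lam0\<bar> + \<epsilon>) 1) * norm x * (ln (norm x)) powr ((\<beta> - 1) / \<beta>))) \<le> \<phi>\<^sub>0 x"
    if "0 < \<epsilon>" "exp 1 \<le> norm x" for \<epsilon> x
  proof -
    have "1 \<le> ln (norm x)"
      using that(2) by (metis exp_gt_zero less_le_trans ln_ge_iff)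
    then have "1 \<le> (ln (norm x)) powr ((\<beta> - 1) / \<beta>)"
      using \<open>1 < \<beta>\<close> by (intro ge_one_powr_ge_zero) auto
    moreover have "\<sigma> \<le> sqrt (min (\<bar>lam0\<bar> + \<epsilon>) 1)"
      unfolding \<sigma>_def using \<open>0 < \<epsilon>\<close> by (intro real_sqrt_le_mono) auto
    then have "K \<le> K / \<sigma> * sqrt (min (\<bar>lam0\<bar> + \<epsilon>) 1)"
      using \<sigma> K by (simp add: field_simps)
    ultimately have "K * norm x * 1
        \<le> K / \<sigma> * sqrt (min (\<bar>lam0\<bar> + \<epsilon>) 1) * norm x * (ln (norm x)) powr ((\<beta> - 1) / \<beta>)"
      using K \<sigma> \<open>0 < \<epsilon>\<close> by (intro mult_mono mult_right_mono mult_nonneg_nonneg) auto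
    then have "C * exp (- (K / \<sigma> * sqrt (min (\<bar>lam0\<bar> + \<epsilon>) 1) * norm x * (ln (norm x)) powr ((\<beta> - 1) / \<beta>)))
        \<le> C * exp (- (K * norm x))"
      using C by simp
    then show ?thesis
      using bound[of x] by linarith
  qed
  moreover have "0 < K / \<sigma>" "0 < exp (1::real)"
    using K \<sigma> by simp_all
  ultimately show ?thesis
    using C by blast
qed

end
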